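(* Suppose that $f(z)=\sum_{n=0}^{\infty}a_nz^n\in\mathcal{B}$, $a:=|a_0|$ and $\omega\in\mathcal{B}_m$ for some $m\ge 1$. We have the following: (1) If $m=1$, then we have $$I_f(z):=B_0(f,r)+\frac{1+ar}{(1+a)(1-r)}\|f_0\|_r^2+|f(\omega(z))-a_0|^2\le 1\quad\text{for } |z|=r\le 1/3 \qquad ( * )$$ if and only if $0\le a\le a^{*}=-5+4\sqrt{2}\approx 0.656854$. The constant $1/3$ cannot be improved. (2) If $m\ge 2$, then $( * )$ holds, and the constant $1/3$ cannot be improved.
   Context: $\mathbb{D}=\{z\in\mathbb{C}:|z|<1\}$ and $\mathbb{N}=\{1,2,\dots\}$. $\mathcal{B}$ is the class of analytic functions $f$ on $\mathbb{D}$ with $\|f\|_\infty=\sup_{z\in\mathbb{D}}|f(z)|\le 1$. For $m\in\mathbb{N}$, $\mathcal{B}_m$ is the set of $\omega\in\mathcal{B}$ with $\omega(0)=\cdots=\omega^{(m-1)}(0)=0$ and $\omega^{(m)}(0)\ne 0$. For $f(z)=\sum_{n=0}^{\infty}a_nz^n\in\mathcal{B}$ put $f_0(z)=f(z)-f(0)$, $B_k(f,r)=\sum_{n=k}^{\infty}|a_n|r^n$ for $k\ge 0$ (so $B_0(f,r)=\sum_{n=0}^{\infty}|a_n|r^n$), and $\|f_0\|_r^2=\sum_{n=1}^{\infty}|a_n|^2r^{2n}$.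
   Formalization: In (1) the equivalence is for each fixed a with 0 ≤ a < 1, with ( * ) required for all f with |a_0| = a and all ω in B_1; a = 1 is excluded because f is then a unimodular constant, I_f = 1 and ( * ) holds although a > a*. *)

theory Defs
  imports "HOL-Complex_Analysis.Complex_Analysis"
begin

text \<open>The supremum bound is stated pointwise, because the real-valued \<^const>\<open>Sup\<close> is
  unspecified on unbounded sets.\<close>

definition schur_class :: "(complex \<Rightarrow> complex) set" where
  "schur_class = {f. f holomorphic_on ball 0 1 \<and> (\<forall>z\<in>ball 0 1. cmod (f z) \<le> 1)}"

definition schur_class_order :: "nat \<Rightarrow> (complex \<Rightarrow> complex) set" where
  "schur_class_order m =
    {\<omega> \<in> schur_class. (\<forall>k<m. (deriv ^^ k) \<omega> 0 = 0) \<and> (deriv ^^ m) \<omega> 0 \<noteq> 0}"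

definition taylor_coeff :: "(complex \<Rightarrow> complex) \<Rightarrow> nat \<Rightarrow> complex" where
  "taylor_coeff f n = fps_nth (fps_expansion f 0) n"

text \<open>The two series below are meant for \<open>f\<close> in \<^const>\<open>schur_class\<close> and \<open>0 \<le> r < 1\<close>, where they
  converge.  Both are reindexed to start at \<open>n = 0\<close>.\<close>

definition bohr_sum :: "nat \<Rightarrow> (complex \<Rightarrow> complex) \<Rightarrow> real \<Rightarrow> real" where
  "bohr_sum k f r = (\<Sum>n. cmod (taylor_coeff f (n + k)) * r ^ (n + k))"

text \<open>This is the square of the \<open>r\<close>-norm of \<open>\<lambda>z. f z - f 0\<close>, so the constant
  coefficient is left out.\<close>

definition norm0_sq :: "(complex \<Rightarrow> complex) \<Rightarrow> real \<Rightarrow> real" where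
  "norm0_sq f r = (\<Sum>n. (cmod (taylor_coeff f (Suc n)))\<^sup>2 * r ^ (2 * Suc n))"

definition bohr_functional :: "(complex \<Rightarrow> complex) \<Rightarrow> (complex \<Rightarrow> complex) \<Rightarrow> complex \<Rightarrow> real" where
  "bohr_functional f \<omega> z =
    (let r = cmod z; a = cmod (taylor_coeff f 0) in
      bohr_sum 0 f r
      + (1 + a * r) / ((1 + a) * (1 - r)) * norm0_sq f r
      + (cmod (f (\<omega> z) - taylor_coeff f 0))\<^sup>2)"

end

theory Submission
  imports Defs
begin

text \<open>
  The functional has two parts, estimated separately.  Carlson's inequalities
  \<open>|a\<^sub>2\<^sub>n\<^sub>+\<^sub>1| \<le> 1 - (|a\<^sub>0|\<^sup>2 + \<dots> + |a\<^sub>n|\<^sup>2)\<close> and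
  \<open>|a\<^sub>2\<^sub>n| \<le> 1 - (|a\<^sub>0|\<^sup>2 + \<dots> + |a\<^sub>n\<^sub>-\<^sub>1|\<^sup>2) - |a\<^sub>n|\<^sup>2 / (1 + |a\<^sub>0|)\<close>
  (\<open>carlson_odd\<close>, \<open>carlson_even\<close>), multiplied by powers of \<open>r\<close> and added up, bound the Bohr sum plus the
  term with the square norm by \<open>a + (1 - a\<^sup>2) r / (1 - r)\<close> (\<open>refined_bohr\<close>).  They hold because
  multiplication by \<open>f\<close> does not increase the mean square on circles, so that the lower triangular
  Toeplitz matrix of the Taylor coefficients is a contraction (\<open>toeplitz_contraction\<close>).

  For \<open>r \<le> 1/3\<close> this bound is at most \<open>1 - (1 - a)\<^sup>2 / 2\<close>, so that \<open>(1 - a)\<^sup>2 / 2\<close> is left for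
  \<open>|f(\<omega>(z)) - a\<^sub>0|\<^sup>2\<close>.  By the Schwarz--Pick lemma \<open>|f(\<omega>(z)) - a\<^sub>0| \<le> (1 - a\<^sup>2) s / (1 - a s)\<close> with
  \<open>s = |\<omega>(z)|\<close>, so it suffices that \<open>\<surd>2 (1 + a) s \<le> 1 - a s\<close>.  If \<open>m = 1\<close>, then \<open>s \<le> 1/3\<close> by the
  Schwarz lemma, and at \<open>s = 1/3\<close> the condition reads \<open>a \<le> -5 + 4 \<surd>2\<close>.  If \<open>m \<ge> 2\<close>, then \<open>s \<le> 1/6\<close>,
  and the condition holds for all \<open>a \<le> 1\<close>.

  The automorphism \<open>z \<mapsto> (a - z) / (1 - a z)\<close> with \<open>\<omega>(z) = z\<close> and \<open>z = r\<close> attains equality in both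
  estimates (\<open>refined_bohr_disc_swap\<close>, \<open>bohr_functional_disc_swap_id_gt_1\<close>).  This gives the necessity
  of the bound on \<open>a\<close> and, with \<open>a = -5 + 4 \<surd>2\<close>, the sharpness of \<open>1/3\<close> for \<open>m = 1\<close>.  For \<open>m \<ge> 2\<close> and
  \<open>r > 1/3\<close>, the first two terms alone exceed \<open>1\<close> when \<open>a\<close> is close to \<open>1\<close>.
\<close>

section \<open>Multiplication by a bounded function contracts coefficient sequences\<close>

text \<open>Parseval's identity on the \<open>N\<close>-th roots of unity.\<close>

lemma sum_norm_sq_poly_roots_of_unity:
  fixes P :: "complex poly"
  assumes "degree P < N"
  shows "(\<Sum>j<N. (cmod (poly P (cis (2 * pi * real j / real N))))\<^sup>2)
           = real N * (\<Sum>k<N. (cmod (coeff P k))\<^sup>2)"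
proof -
  have N: "N > 0" using assms by simp
  define \<zeta> where "\<zeta> = cis (2 * pi / real N)"
  have pow: "cis (2 * pi * real k / real N) = \<zeta> ^ k" for k
    unfolding \<zeta>_def Complex.DeMoivre by (rule arg_cong[of _ _ cis]) simp
  have \<zeta>1: "\<zeta> ^ N = 1"
    using pow[of N] N by (simp add: complex_eq_iff)
  have cc: "\<zeta> * cnj \<zeta> = 1"
    by (simp add: \<zeta>_def cis_cnj cis_mult)
  have orth: "(\<Sum>j<N. (\<zeta> ^ j) ^ k * cnj ((\<zeta> ^ j) ^ l)) = (if k = l then of_nat N else 0)"
    if kl: "k < N" "l < N" for k l
  proof -
    define x where "x = \<zeta> ^ k * cnj \<zeta> ^ l"
    have x: "(\<zeta> ^ j) ^ k * cnj ((\<zeta> ^ j) ^ l) = x ^ j" for j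
      by (simp add: x_def power_mult_distrib flip: power_mult) (simp add: mult_ac)
    show ?thesis
    proof (cases "k = l")
      case True
      then have "x = 1"
        by (simp add: x_def cc flip: power_mult_distrib)
      then show ?thesis unfolding x using True by simp
    next
      case False
      have "inj_on (\<lambda>k. cis (2 * pi * real k / real N)) {..<N}"
        using Complex.bij_betw_roots_unity[OF N] by (simp add: bij_betw_def)
      then have ne: "\<zeta> ^ k \<noteq> \<zeta> ^ l"
        using False kl unfolding pow inj_on_def by blast
      have "x \<noteq> 1"
      proof
        assume "x = 1"
        then have "\<zeta> ^ k * (cnj \<zeta> ^ l * \<zeta> ^ l) = \<zeta> ^ l"
          by (simp add: x_def mult.assoc)
        moreover have "cnj \<zeta> ^ l * \<zeta> ^ l = 1"
          using cc by (simp add: mult.commute flip: power_mult_distrib)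
        ultimately show False using ne by simp
      qed
      moreover have "x ^ N = 1"
      proof -
        have "x ^ N = (\<zeta> ^ N) ^ k * cnj (\<zeta> ^ N) ^ l"
          by (simp add: x_def power_mult_distrib flip: power_mult) (simp add: mult_ac)
        then show ?thesis by (simp only: \<zeta>1) simp
      qed
      ultimately show ?thesis unfolding x using False by (simp add: geometric_sum)
    qed
  qed
  have poly: "poly P x = (\<Sum>k<N. coeff P k * x ^ k)" for x
    unfolding poly_altdef
    by (rule sum.mono_neutral_left) (use assms in \<open>auto simp: coeff_eq_0\<close>)
  have "complex_of_real (\<Sum>j<N. (cmod (poly P (\<zeta> ^ j)))\<^sup>2)
      = (\<Sum>j<N. \<Sum>k<N. \<Sum>l<N. coeff P k * cnj (coeff P l) * ((\<zeta> ^ j) ^ k * cnj ((\<zeta> ^ j) ^ l)))"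
    unfolding of_real_sum complex_norm_square poly cnj_sum sum_product
    by (intro sum.cong refl) (simp add: mult_ac)
  also have "\<dots> = (\<Sum>k<N. \<Sum>l<N. coeff P k * cnj (coeff P l) *
                     (\<Sum>j<N. (\<zeta> ^ j) ^ k * cnj ((\<zeta> ^ j) ^ l)))"
    unfolding sum_distrib_left
    by (subst sum.swap) (rule sum.cong[OF refl], rule sum.swap)
  also have "\<dots> = (\<Sum>k<N. \<Sum>l<N. if k = l then coeff P k * cnj (coeff P l) * of_nat N else 0)"
    by (intro sum.cong refl) (simp only: orth lessThan_iff, simp)
  also have "\<dots> = (\<Sum>k<N. coeff P k * cnj (coeff P k) * of_nat N)"
    by (intro sum.cong refl) (simp add: sum.delta)
  also have "\<dots> = complex_of_real (real N * (\<Sum>k<N. (cmod (coeff P k))\<^sup>2))"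
    by (simp add: complex_norm_square sum_distrib_left mult_ac del: of_real_power)
  finally show ?thesis
    unfolding pow of_real_eq_iff .
qed

lemma taylor_coeff_sums:
  assumes "f \<in> schur_class" "cmod z < 1"
  shows "(\<lambda>n. taylor_coeff f n * z ^ n) sums f z"
  using holomorphic_power_series[of f 0 1 z] assms
  by (simp add: schur_class_def taylor_coeff_def fps_expansion_def)

lemma taylor_coeff_eqI: "f has_fps_expansion F \<Longrightarrow> taylor_coeff f n = fps_nth F n"
  by (simp add: taylor_coeff_def fps_expansion_eqI)

lemma taylor_coeff_0: "taylor_coeff f 0 = f 0"
  by (simp add: taylor_coeff_def fps_expansion_def)

text \<open>With \<open>f(\<rho> z)\<close> in place of \<open>f\<close>, the Taylor series converges uniformly on the unit circle, so
  its partial sums are bounded there by \<open>1 + \<epsilon>\<close>.  For the polynomial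
  \<open>P\<close> with coefficients \<open>p\<close>, Parseval's identity then bounds the square norm of the coefficients of
  partial sum times \<open>P\<close> by \<open>(1 + \<epsilon>)\<^sup>2\<close> times that of \<open>p\<close>.\<close>

lemma toeplitz_contraction_dilated:
  fixes \<rho> :: real and p :: "nat \<Rightarrow> complex"
  assumes f: "f \<in> schur_class" and \<rho>: "0 < \<rho>" "\<rho> < 1"
  shows "(\<Sum>k\<le>n. (cmod (\<Sum>i\<le>k. p i * (taylor_coeff f (k - i) * of_real \<rho> ^ (k - i))))\<^sup>2)
           \<le> (\<Sum>i\<le>n. (cmod (p i))\<^sup>2)" (is "?L \<le> ?R")
proof -
  define b where "b k = taylor_coeff f k * of_real \<rho> ^ k" for k
  have summ: "summable (\<lambda>k. cmod (b k))"
  proof -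
    obtain s where s: "\<rho> < s" "s < 1" using \<rho> dense by blast
    have "summable (\<lambda>k. taylor_coeff f k * of_real s ^ k)"
      using taylor_coeff_sums[OF f, of "of_real s"] s \<rho> by (simp add: sums_iff)
    then have "summable (\<lambda>k. cmod (taylor_coeff f k * of_real \<rho> ^ k))"
      by (rule powser_insidea) (use s \<rho> in auto)
    then show ?thesis by (simp add: b_def)
  qed
  define \<epsilon> where "\<epsilon> M = (\<Sum>k. cmod (b (k + M)))" for M
  have \<epsilon>: "\<epsilon> \<longlonglongrightarrow> 0"
    unfolding \<epsilon>_def using suminf_exist_split2[OF summ] .
  have \<epsilon>_nonneg: "\<epsilon> M \<ge> 0" for M
    unfolding \<epsilon>_def by (intro suminf_nonneg summable_ignore_initial_segment summ) simp
  \<comment> \<open>\<open>F M\<close> is the partial sum of \<open>f(\<rho> z)\<close> up to degree \<open>M\<close>.\<close>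
  define P where "P = (\<Sum>i\<le>n. monom (p i) i)"
  define F where "F M = (\<Sum>k\<le>M. monom (b k) k)" for M
  have cP: "coeff P k = (if k \<le> n then p k else 0)" for k
    by (simp add: P_def coeff_sum)
  have cF: "coeff (F M) k = (if k \<le> M then b k else 0)" for k M
    by (simp add: F_def coeff_sum)
  have degP: "degree P \<le> n"
    unfolding P_def by (rule degree_sum_le) (auto intro: order_trans[OF degree_monom_le])
  have degF: "degree (F M) \<le> M" for M
    unfolding F_def by (rule degree_sum_le) (auto intro: order_trans[OF degree_monom_le])
  have bound: "cmod (poly (F M) x) \<le> 1 + \<epsilon> (Suc M)" if x: "cmod x = 1" for M x
  proof -
    have sums: "(\<lambda>k. b k * x ^ k) sums f (of_real \<rho> * x)"
      using taylor_coeff_sums[OF f, of "of_real \<rho> * x"] \<rho> x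
      by (simp add: b_def norm_mult power_mult_distrib mult_ac)
    have "f (of_real \<rho> * x) = (\<Sum>k. b (k + Suc M) * x ^ (k + Suc M)) + (\<Sum>k<Suc M. b k * x ^ k)"
      using suminf_split_initial_segment[of "\<lambda>k. b k * x ^ k" "Suc M"] sums by (simp add: sums_iff)
    moreover have "poly (F M) x = (\<Sum>k<Suc M. b k * x ^ k)"
      by (simp only: F_def poly_sum poly_monom lessThan_Suc_atMost)
    ultimately have "poly (F M) x = f (of_real \<rho> * x) - (\<Sum>k. b (k + Suc M) * x ^ (k + Suc M))"
      by simp
    moreover have "cmod (f (of_real \<rho> * x)) \<le> 1"
      using f \<rho> x by (simp add: schur_class_def norm_mult)
    moreover have "cmod (\<Sum>k. b (k + Suc M) * x ^ (k + Suc M)) \<le> \<epsilon> (Suc M)"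
    proof -
      have eq: "cmod (b (k + Suc M) * x ^ (k + Suc M)) = cmod (b (k + Suc M))" for k
        using x by (simp add: norm_mult norm_power)
      have "cmod (\<Sum>k. b (k + Suc M) * x ^ (k + Suc M))
          \<le> (\<Sum>k. cmod (b (k + Suc M) * x ^ (k + Suc M)))"
        by (rule summable_norm) (simp only: eq summable_ignore_initial_segment[OF summ])
      then show ?thesis by (simp only: eq \<epsilon>_def)
    qed
    ultimately show ?thesis
      by (smt (verit) norm_triangle_ineq4)
  qed
  have step: "?L \<le> (1 + \<epsilon> (Suc M))\<^sup>2 * ?R" if M: "M \<ge> n" for M
  proof -
    \<comment> \<open>More nodes than the degree of \<open>P * F M\<close>, so that Parseval's identity applies to it.\<close>
    define N where "N = Suc (n + M)"
    define w where "w j = cis (2 * pi * real j / real N)" for j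
    define Q where "Q = P * F M"
    have degQ: "degree Q < N"
      using degree_mult_le[of P "F M"] degP degF[of M] by (simp add: Q_def N_def)
    have cQ: "coeff Q k = (\<Sum>i\<le>k. p i * b (k - i))" if "k \<le> n" for k
      unfolding Q_def coeff_mult
      by (intro sum.cong refl) (use that M in \<open>auto simp: cP cF\<close>)
    have "real N * ?L = real N * (\<Sum>k\<le>n. (cmod (coeff Q k))\<^sup>2)"
      by (simp add: cQ b_def)
    also have "\<dots> \<le> real N * (\<Sum>k<N. (cmod (coeff Q k))\<^sup>2)"
      by (intro mult_left_mono sum_mono2) (auto simp: N_def)
    also have "\<dots> = (\<Sum>j<N. (cmod (poly Q (w j)))\<^sup>2)"
      unfolding w_def using sum_norm_sq_poly_roots_of_unity[OF degQ] by simp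
    also have "\<dots> \<le> (\<Sum>j<N. (1 + \<epsilon> (Suc M))\<^sup>2 * (cmod (poly P (w j)))\<^sup>2)"
    proof (intro sum_mono)
      fix j
      have "cmod (poly (F M) (w j)) \<le> 1 + \<epsilon> (Suc M)"
        by (rule bound) (simp add: w_def)
      then show "(cmod (poly Q (w j)))\<^sup>2 \<le> (1 + \<epsilon> (Suc M))\<^sup>2 * (cmod (poly P (w j)))\<^sup>2"
        unfolding Q_def poly_mult norm_mult power_mult_distrib
        by (subst mult.commute) (intro mult_right_mono power_mono; simp)
    qed
    also have "\<dots> = (1 + \<epsilon> (Suc M))\<^sup>2 * (real N * (\<Sum>k<N. (cmod (coeff P k))\<^sup>2))"
      unfolding w_def sum_distrib_left[symmetric]
      by (subst sum_norm_sq_poly_roots_of_unity) (use degP in \<open>auto simp: N_def\<close>)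
    also have "(\<Sum>k<N. (cmod (coeff P k))\<^sup>2) = ?R"
      by (rule sum.mono_neutral_cong_right) (auto simp: N_def cP)
    finally have "real N * ?L \<le> real N * ((1 + \<epsilon> (Suc M))\<^sup>2 * ?R)"
      by (simp add: mult_ac)
    then show ?thesis by (simp add: N_def)
  qed
  have "(\<lambda>M. (1 + \<epsilon> (Suc M))\<^sup>2 * ?R) \<longlonglongrightarrow> (1 + 0)\<^sup>2 * ?R"
    by (intro tendsto_intros LIMSEQ_Suc \<epsilon>)
  then have "?L \<le> (1 + 0)\<^sup>2 * ?R"
    by (rule Lim_bounded2) (use step in blast)
  then show ?thesis by simp
qed

text \<open>The lower triangular Toeplitz matrix of the Taylor coefficients is a contraction; this is the
  limit \<open>\<rho> \<rightarrow> 1\<close> of the previous lemma.\<close>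

lemma toeplitz_contraction:
  fixes p :: "nat \<Rightarrow> complex"
  assumes f: "f \<in> schur_class"
  shows "(\<Sum>k\<le>n. (cmod (\<Sum>i\<le>k. p i * taylor_coeff f (k - i)))\<^sup>2) \<le> (\<Sum>i\<le>n. (cmod (p i))\<^sup>2)"
proof -
  define L :: "real \<Rightarrow> real" where
    "L \<rho> = (\<Sum>k\<le>n. (cmod (\<Sum>i\<le>k. p i * (taylor_coeff f (k - i) * of_real \<rho> ^ (k - i))))\<^sup>2)" for \<rho>
  have "isCont L 1"
    unfolding L_def by (intro continuous_intros)
  then have "(L \<longlongrightarrow> L 1) (at_left 1)"
    using isCont_def tendsto_within_subset by blast
  then have "L 1 \<le> (\<Sum>i\<le>n. (cmod (p i))\<^sup>2)"
  proof (rule tendsto_upperbound)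
    show "\<forall>\<^sub>F \<rho> in at_left 1. L \<rho> \<le> (\<Sum>i\<le>n. (cmod (p i))\<^sup>2)"
      using eventually_at_left_real[OF zero_less_one]
      by (rule eventually_mono) (use toeplitz_contraction_dilated[OF f] in \<open>simp add: L_def\<close>)
  qed simp
  then show ?thesis by (simp add: L_def)
qed

lemma toeplitz_bilinear_le:
  fixes p y :: "nat \<Rightarrow> complex"
  assumes f: "f \<in> schur_class"
  shows "2 * Re (\<Sum>k\<le>n. y k * (\<Sum>i\<le>k. p i * taylor_coeff f (k - i)))
           \<le> (\<Sum>k\<le>n. (cmod (y k))\<^sup>2) + (\<Sum>i\<le>n. (cmod (p i))\<^sup>2)"
proof -
  have *: "2 * Re (u * v) \<le> (cmod u)\<^sup>2 + (cmod v)\<^sup>2" for u v :: complex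
    using complex_Re_le_cmod[of "u * v"] sum_squares_bound[of "cmod u" "cmod v"]
    by (simp add: norm_mult)
  have "2 * Re (\<Sum>k\<le>n. y k * (\<Sum>i\<le>k. p i * taylor_coeff f (k - i)))
      \<le> (\<Sum>k\<le>n. (cmod (y k))\<^sup>2 + (cmod (\<Sum>i\<le>k. p i * taylor_coeff f (k - i)))\<^sup>2)"
    unfolding Re_sum[of _ "{..n}"] sum_distrib_left[of 2 _ "{..n}"] by (intro sum_mono *)
  also have "\<dots> \<le> (\<Sum>k\<le>n. (cmod (y k))\<^sup>2) + (\<Sum>i\<le>n. (cmod (p i))\<^sup>2)"
    using toeplitz_contraction[OF f, of p n] by (simp add: sum.distrib)
  finally show ?thesis .
qed

section \<open>Carlson's coefficient inequalities and the refined Bohr inequality\<close>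

lemma sum_atMost_double_split:
  fixes h :: "nat \<Rightarrow> 'a::comm_monoid_add"
  shows "(\<Sum>k\<le>2*n. h k) = (\<Sum>k<n. h k) + h n + (\<Sum>j<n. h (2*n - j))"
proof -
  have "(\<Sum>j<n. h (2*n - j)) = (\<Sum>k\<in>{n<..2*n}. h k)"
    by (rule sum.reindex_bij_witness[of _ "\<lambda>k. 2*n - k" "\<lambda>j. 2*n - j"]) auto
  moreover have "{..2*n} = {..n} \<union> {n<..2*n}" by auto
  then have "(\<Sum>k\<le>2*n. h k) = (\<Sum>k\<le>n. h k) + (\<Sum>k\<in>{n<..2*n}. h k)"
    by (simp only:) (rule sum.union_disjoint; auto)
  ultimately show ?thesis
    by (simp flip: lessThan_Suc_atMost)
qed

text \<open>The Toeplitz form is evaluated at the vectors \<open>p\<close> and \<open>y\<close> supported on the indices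
  \<open>0, n, n + 1, \<dots>, 2n\<close> and \<open>0, \<dots>, n, 2n\<close>.  Between these indices the matrix is the block matrix
  with rows \<open>(x, 0, 0)\<close>, \<open>(a\<^sub>n, a\<^sub>0, 0)\<close>, \<open>(a\<^sub>2\<^sub>n, a\<^sub>n, x\<^sup>T)\<close>, where \<open>x\<close> consists of
  \<open>a\<^sub>0, \<dots>, a\<^sub>n\<^sub>-\<^sub>1\<close> (in reverse order in the last row), and the inequality holds because that
  matrix is a contraction.\<close>

lemma carlson_even:
  assumes f: "f \<in> schur_class" and n: "n \<ge> 1"
  shows "cmod (taylor_coeff f (2*n)) \<le> 1 - (\<Sum>j<n. (cmod (taylor_coeff f j))\<^sup>2)
           - (cmod (taylor_coeff f n))\<^sup>2 / (1 + cmod (taylor_coeff f 0))"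
proof -
  define a where "a = taylor_coeff f"
  define A where "A = cmod (a 0)"
  define B where "B = (cmod (a n))\<^sup>2"
  define S where "S = (\<Sum>j<n. (cmod (a j))\<^sup>2)"
  have A: "A \<ge> 0" by (simp add: A_def)
  obtain w where w: "cmod w = 1" "w * a (2*n) = of_real (cmod (a (2*n)))"
  proof (cases "a (2*n) = 0")
    case True
    then show ?thesis using that[of 1] by simp
  next
    case False
    have "cnj (sgn (a (2*n))) * a (2*n) = of_real ((cmod (a (2*n)))\<^sup>2) / of_real (cmod (a (2*n)))"
      unfolding complex_norm_square by (simp add: sgn_eq mult.commute)
    also have "\<dots> = of_real (cmod (a (2*n)))"
      using False by (simp add: power2_eq_square)
    finally have "cnj (sgn (a (2*n))) * a (2*n) = of_real (cmod (a (2*n)))" .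
    then show ?thesis using that[of "cnj (sgn (a (2*n)))"] False by (simp add: norm_sgn)
  qed
  have ww: "w * cnj w = 1"
    using w(1) by (simp flip: complex_norm_square)
  \<comment> \<open>Modulus \<open>|a\<^sub>n| / (1 + A)\<close> is the best choice of \<open>t\<close> in \<open>2 * |a\<^sub>n| * t - (1 + A) * t\<^sup>2\<close>, where
      the term with \<open>A\<close> is the worst case of \<open>Re (v * q * a\<^sub>0)\<close>.\<close>
  define v where "v = cnj (a n) / of_real (1 + A)"
  define q where "q = cnj (w * a n) / of_real (1 + A)"
  define y where "y k = (if k < n then cnj (a k) else if k = n then v else if k = 2*n then w else 0)" for k
  define p where "p i = (if i = 0 then 1 else if i < n then 0 else if i = n then q
                         else cnj (w * a (2*n - i)))" for i
  have conv: "(\<Sum>i\<le>k. p i * a (k - i)) = a k" if "k < n" for k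
  proof -
    have "(\<Sum>i\<le>k. p i * a (k - i)) = (\<Sum>i\<le>k. if i = 0 then a k else 0)"
      by (intro sum.cong refl) (use that in \<open>auto simp: p_def\<close>)
    then show ?thesis by simp
  qed
  have conv_n: "(\<Sum>i\<le>n. p i * a (n - i)) = a n + q * a 0"
  proof -
    have "(\<Sum>i<n. p i * a (n - i)) = (\<Sum>i<n. if i = 0 then a n else 0)"
      by (intro sum.cong refl) (auto simp: p_def)
    then show ?thesis using n by (simp add: p_def flip: lessThan_Suc_atMost)
  qed
  have conv_2n: "(\<Sum>i\<le>2*n. p i * a (2*n - i)) = a (2*n) + q * a n + cnj w * of_real S"
  proof -
    have "(\<Sum>i<n. p i * a (2*n - i)) = (\<Sum>i<n. if i = 0 then a (2*n) else 0)"
      by (intro sum.cong refl) (auto simp: p_def)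
    moreover have "(\<Sum>j<n. p (2*n - j) * a (2*n - (2*n - j))) = cnj w * of_real S"
      unfolding S_def of_real_sum sum_distrib_left
      by (intro sum.cong refl) (auto simp: p_def complex_norm_square mult_ac simp del: of_real_power)
    ultimately show ?thesis
      using n by (simp add: sum_atMost_double_split p_def)
  qed
  have norm_y: "(\<Sum>k\<le>2*n. (cmod (y k))\<^sup>2) = S + (cmod v)\<^sup>2 + 1"
  proof -
    have "(\<Sum>j<n. (cmod (y (2*n - j)))\<^sup>2) = (\<Sum>j<n. if j = 0 then 1 else 0)"
      by (intro sum.cong refl) (auto simp: y_def w)
    then show ?thesis
      using n by (simp add: sum_atMost_double_split) (simp add: y_def S_def)
  qed
  have norm_p: "(\<Sum>k\<le>2*n. (cmod (p k))\<^sup>2) = 1 + (cmod q)\<^sup>2 + S"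
  proof -
    have "(\<Sum>i<n. (cmod (p i))\<^sup>2) = (\<Sum>i<n. if i = 0 then 1 else 0)"
      by (intro sum.cong refl) (auto simp: p_def)
    moreover have "(\<Sum>j<n. (cmod (p (2*n - j)))\<^sup>2) = S"
      unfolding S_def by (intro sum.cong refl) (auto simp: p_def w norm_mult)
    ultimately show ?thesis
      using n by (simp add: sum_atMost_double_split p_def)
  qed
  have vq: "(cmod v)\<^sup>2 = B / (1 + A)\<^sup>2" "(cmod q)\<^sup>2 = B / (1 + A)\<^sup>2"
    using A w(1) by (simp_all add: v_def q_def B_def norm_divide norm_mult power_divide del: of_real_add)
  have form: "(\<Sum>k\<le>2*n. y k * (\<Sum>i\<le>k. p i * a (k - i)))
      = of_real S + v * (a n + q * a 0) + w * (a (2*n) + q * a n + cnj w * of_real S)"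
  proof -
    define G where "G k = (\<Sum>i\<le>k. p i * a (k - i))" for k
    have "(\<Sum>k<n. y k * G k) = of_real S"
      unfolding S_def of_real_sum G_def
      by (intro sum.cong refl) (simp add: y_def conv complex_norm_square mult.commute del: of_real_power)
    moreover have "(\<Sum>j<n. y (2*n - j) * G (2*n - j)) = (\<Sum>j<n. if j = 0 then w * G (2*n) else 0)"
      by (intro sum.cong refl) (auto simp: y_def)
    moreover have "y n * G n = v * (a n + q * a 0)"
      by (simp add: y_def G_def conv_n)
    ultimately have "(\<Sum>k\<le>2*n. y k * G k) = of_real S + v * (a n + q * a 0) + w * G (2*n)"
      using n by (simp add: sum_atMost_double_split)
    then show ?thesis
      unfolding G_def conv_2n .
  qed
  have vb: "v * a n = of_real (B / (1 + A))" "w * q * a n = of_real (B / (1 + A))"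
  proof -
    have "v * a n = a n * cnj (a n) / of_real (1 + A)"
      "w * q * a n = (w * cnj w) * (a n * cnj (a n)) / of_real (1 + A)"
      by (simp_all add: v_def q_def mult_ac)
    then show "v * a n = of_real (B / (1 + A))" "w * q * a n = of_real (B / (1 + A))"
      unfolding ww of_real_divide B_def complex_norm_square by simp_all
  qed
  have "Re (v * q * a 0) \<ge> - cmod (v * q * a 0)"
    using complex_Re_le_cmod[of "- (v * q * a 0)"] by simp
  moreover have "cmod (v * q * a 0) = B / (1 + A)\<^sup>2 * A"
    using A w(1) by (simp add: v_def q_def B_def norm_divide norm_mult A_def power2_eq_square
        del: of_real_add)
  ultimately have "Re (v * q * a 0) \<ge> - (B / (1 + A)\<^sup>2 * A)" by simp
  moreover have "Re (of_real S + v * (a n + q * a 0) + w * (a (2*n) + q * a n + cnj w * of_real S))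
      = 2 * S + cmod (a (2*n)) + 2 * (B / (1 + A)) + Re (v * q * a 0)"
  proof -
    have "of_real S + v * (a n + q * a 0) + w * (a (2*n) + q * a n + cnj w * of_real S)
        = of_real S + v * a n + v * q * a 0 + w * a (2*n) + w * q * a n + (w * cnj w) * of_real S"
      by (simp add: algebra_simps)
    then show ?thesis by (simp only: vb w(2) ww) simp
  qed
  moreover have "2 * Re (of_real S + v * (a n + q * a 0) + w * (a (2*n) + q * a n + cnj w * of_real S))
      \<le> (S + B / (1 + A)\<^sup>2 + 1) + (1 + B / (1 + A)\<^sup>2 + S)"
    using toeplitz_bilinear_le[OF f, of y p "2*n"] unfolding a_def[symmetric] form norm_y norm_p vq .
  ultimately have "cmod (a (2*n)) + S + 2 * (B / (1 + A)) - B / (1 + A)\<^sup>2 * A - B / (1 + A)\<^sup>2 \<le> 1"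
    by linarith
  moreover have "B / (1 + A)\<^sup>2 * A + B / (1 + A)\<^sup>2 = B / (1 + A)"
    using A by (simp add: divide_simps power2_eq_square) (simp add: algebra_simps)
  ultimately show ?thesis
    by (simp add: a_def A_def B_def S_def)
qed

lemma schur_class_has_fps_expansion:
  "f \<in> schur_class \<Longrightarrow> f has_fps_expansion fps_expansion f 0"
  by (rule has_fps_expansion_fps_expansion[of "ball 0 1"]) (auto simp: schur_class_def)

text \<open>This is the even case for \<open>z * f(z)\<close>, whose Taylor coefficients are those of \<open>f\<close> shifted by one
  place and whose value at \<open>0\<close> is \<open>0\<close>.\<close>

lemma carlson_odd:
  assumes f: "f \<in> schur_class"
  shows "cmod (taylor_coeff f (2*n + 1)) \<le> 1 - (\<Sum>j\<le>n. (cmod (taylor_coeff f j))\<^sup>2)"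
proof -
  define g where "g = (\<lambda>z. z * f z)"
  have g: "g \<in> schur_class"
    unfolding g_def schur_class_def
  proof (intro CollectI conjI ballI)
    show "(\<lambda>z. z * f z) holomorphic_on ball 0 1"
      using f by (auto simp: schur_class_def intro!: holomorphic_intros)
    show "cmod (z * f z) \<le> 1" if "z \<in> ball 0 1" for z
      using f that mult_mono[of "cmod z" 1 "cmod (f z)" 1] by (simp add: schur_class_def norm_mult)
  qed
  have "g has_fps_expansion fps_X * fps_expansion f 0"
    unfolding g_def by (intro fps_expansion_intros schur_class_has_fps_expansion f)
  then have coeff: "taylor_coeff g k = (if k = 0 then 0 else taylor_coeff f (k - 1))" for k
    by (simp add: taylor_coeff_eqI taylor_coeff_def[of f])
  have "(\<Sum>j<Suc n. (cmod (taylor_coeff g j))\<^sup>2) = (\<Sum>j<n. (cmod (taylor_coeff f j))\<^sup>2)"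
    by (subst sum.lessThan_Suc_shift) (simp add: coeff)
  then show ?thesis
    using carlson_even[OF g, of "Suc n"] by (simp add: coeff flip: lessThan_Suc_atMost)
qed

lemma taylor_coeff_norm_le_1:
  assumes "f \<in> schur_class"
  shows "cmod (taylor_coeff f n) \<le> 1"
proof (cases "n = 0")
  case True
  then show ?thesis using assms by (simp add: taylor_coeff_0 schur_class_def)
next
  case False
  show ?thesis
  proof (cases "even n")
    case True
    then obtain k where k: "n = 2 * k" by (rule evenE)
    have "0 \<le> (\<Sum>j<k. (cmod (taylor_coeff f j))\<^sup>2)"
      "0 \<le> (cmod (taylor_coeff f k))\<^sup>2 / (1 + cmod (taylor_coeff f 0))"
      by (simp_all add: sum_nonneg)
    moreover have "k \<ge> 1" using \<open>n \<noteq> 0\<close> k by simp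
    ultimately show ?thesis
      using carlson_even[OF assms, of k] unfolding k by linarith
  next
    case False
    then obtain k where k: "n = 2 * k + 1" by (rule oddE)
    have "0 \<le> (\<Sum>j\<le>k. (cmod (taylor_coeff f j))\<^sup>2)"
      by (simp add: sum_nonneg)
    then show ?thesis
      using carlson_odd[OF assms, of k] unfolding k by linarith
  qed
qed

lemma summable_bohr:
  assumes "f \<in> schur_class" "0 \<le> r" "r < 1"
  shows "summable (\<lambda>n. cmod (taylor_coeff f (n + k)) * r ^ (n + k))"
proof -
  have "summable (\<lambda>n. cmod (taylor_coeff f n) * r ^ n)"
  proof (rule summable_comparison_test)
    show "\<exists>N. \<forall>n\<ge>N. norm (cmod (taylor_coeff f n) * r ^ n) \<le> r ^ n"
      using assms by (auto simp: abs_mult intro!: mult_left_le_one_le taylor_coeff_norm_le_1)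
  qed (use assms in \<open>simp add: summable_geometric\<close>)
  then show ?thesis by (rule summable_ignore_initial_segment)
qed

lemma summable_norm0_sq:
  assumes "f \<in> schur_class" "0 \<le> r" "r < 1"
  shows "summable (\<lambda>n. (cmod (taylor_coeff f (Suc n)))\<^sup>2 * r ^ (2 * Suc n))"
proof (rule summable_comparison_test)
  have "r ^ (2 * Suc n) \<le> r ^ n" for n
    using assms by (intro power_decreasing) auto
  moreover have "(cmod (taylor_coeff f (Suc n)))\<^sup>2 \<le> 1" for n
    using taylor_coeff_norm_le_1[OF assms(1)] by (simp add: power_le_one)
  ultimately have "(cmod (taylor_coeff f (Suc n)))\<^sup>2 * r ^ (2 * Suc n) \<le> 1 * r ^ n" for n
    using assms by (intro mult_mono) auto
  then show "\<exists>N. \<forall>n\<ge>N. norm ((cmod (taylor_coeff f (Suc n)))\<^sup>2 * r ^ (2 * Suc n)) \<le> r ^ n"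
    using assms by (auto simp: abs_mult)
qed (use assms in \<open>simp add: summable_geometric\<close>)

text \<open>Carlson's inequalities are summed in pairs of indices \<open>2K + 1, 2K + 2\<close>.  The quantity
  subtracted on the right, \<open>r\<^sup>2\<^sup>K * (1 - |a\<^sub>0|\<^sup>2 - \<dots> - |a\<^sub>K|\<^sup>2)\<close>, makes the induction telescope; it is
  nonnegative and can be dropped afterwards.\<close>

lemma bohr_partial_sum_le:
  assumes f: "f \<in> schur_class" and r: "0 \<le> r" "r < 1"
  defines "a \<equiv> cmod (taylor_coeff f 0)"
  shows "(\<Sum>n<2*K. cmod (taylor_coeff f (Suc n)) * r ^ Suc n)
      + (1 / (1 + a) + r / (1 - r)) * (\<Sum>n<K. (cmod (taylor_coeff f (Suc n)))\<^sup>2 * r ^ (2 * Suc n))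
      \<le> r / (1 - r) * (1 - a\<^sup>2 - r ^ (2*K) * (1 - (\<Sum>j\<le>K. (cmod (taylor_coeff f j))\<^sup>2)))"
proof (induction K)
  case 0
  then show ?case by (simp add: a_def)
next
  case (Suc K)
  define X where "X = cmod (taylor_coeff f (Suc (2*K)))"
  define Y where "Y = cmod (taylor_coeff f (Suc (Suc (2*K))))"
  define B where "B = (cmod (taylor_coeff f (Suc K)))\<^sup>2"
  define E where "E = 1 - (\<Sum>j\<le>K. (cmod (taylor_coeff f j))\<^sup>2)"
  define s where "s = r ^ (2*K)"
  define C where "C = 1 / (1 + a) + r / (1 - r)"
  define U where "U = (\<Sum>n<2*K. cmod (taylor_coeff f (Suc n)) * r ^ Suc n)"
  define V where "V = (\<Sum>n<K. (cmod (taylor_coeff f (Suc n)))\<^sup>2 * r ^ (2 * Suc n))"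
  have s: "s \<ge> 0" using r by (simp add: s_def)
  have a: "a \<ge> 0" by (simp add: a_def)
  have X: "X \<le> E"
    using carlson_odd[OF f, of K] by (simp add: E_def X_def)
  have Y: "Y \<le> E - B / (1 + a)"
    using carlson_even[OF f, of "Suc K"]
    by (simp only: E_def B_def a_def Y_def lessThan_Suc_atMost) simp
  have "X * (s * r) \<le> E * (s * r)" "Y * (s * r\<^sup>2) \<le> (E - B / (1 + a)) * (s * r\<^sup>2)"
    using s r X Y by (intro mult_right_mono; simp)+
  moreover have "r / (1 - r) * (1 - a\<^sup>2 - s * E) + E * (s * r) + (E - B / (1 + a)) * (s * r\<^sup>2)
       + C * (B * (s * r\<^sup>2)) = r / (1 - r) * (1 - a\<^sup>2 - s * r\<^sup>2 * (E - B))"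
  proof -
    have *: "r / (1 - r) * (1 - r\<^sup>2) = r + r\<^sup>2"
      using r by (simp add: field_simps power2_eq_square)
    have "r / (1 - r) * (1 - a\<^sup>2 - s * E) + E * (s * r) + (E - B / (1 + a)) * (s * r\<^sup>2)
       + C * (B * (s * r\<^sup>2)) - r / (1 - r) * (1 - a\<^sup>2 - s * r\<^sup>2 * (E - B))
       = s * E * (r + r\<^sup>2 - r / (1 - r) * (1 - r\<^sup>2))"
      unfolding C_def by (simp add: algebra_simps)
    then show ?thesis unfolding * by simp
  qed
  moreover have "U + C * V \<le> r / (1 - r) * (1 - a\<^sup>2 - s * E)"
    using Suc.IH by (simp only: U_def V_def C_def s_def E_def)
  ultimately have "(U + X * (s * r) + Y * (s * r\<^sup>2)) + C * (V + B * (s * r\<^sup>2))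
      \<le> r / (1 - r) * (1 - a\<^sup>2 - s * r\<^sup>2 * (E - B))"
    unfolding distrib_left[of C] by linarith
  moreover have "(\<Sum>n<2 * Suc K. cmod (taylor_coeff f (Suc n)) * r ^ Suc n)
      = U + X * (s * r) + Y * (s * r\<^sup>2)"
    by (simp add: U_def X_def Y_def s_def power2_eq_square mult_ac)
  moreover have "(\<Sum>n<Suc K. (cmod (taylor_coeff f (Suc n)))\<^sup>2 * r ^ (2 * Suc n))
      = V + B * (s * r\<^sup>2)"
    by (simp add: V_def B_def s_def power2_eq_square mult_ac)
  moreover have "1 - (\<Sum>j\<le>Suc K. (cmod (taylor_coeff f j))\<^sup>2) = E - B"
    by (simp add: E_def B_def)
  moreover have "r ^ (2 * Suc K) = s * r\<^sup>2"
    by (simp add: s_def power2_eq_square mult_ac)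
  ultimately show ?case
    by (simp only: C_def)
qed

text \<open>The factor of the square norm equals \<open>1 / (1 + a) + r / (1 - r)\<close>.\<close>

lemma refined_bohr:
  assumes f: "f \<in> schur_class" and r: "0 \<le> r" "r < 1"
  defines "a \<equiv> cmod (taylor_coeff f 0)"
  shows "bohr_sum 0 f r + (1 + a * r) / ((1 + a) * (1 - r)) * norm0_sq f r
           \<le> a + r / (1 - r) * (1 - a\<^sup>2)"
proof -
  have a: "a \<ge> 0" by (simp add: a_def)
  define C where "C = 1 / (1 + a) + r / (1 - r)"
  have C: "C = (1 + a * r) / ((1 + a) * (1 - r))"
    using a r by (simp add: C_def field_simps add_nonneg_eq_0_iff)
  define u where "u n = cmod (taylor_coeff f (Suc n)) * r ^ Suc n" for n
  define v where "v n = (cmod (taylor_coeff f (Suc n)))\<^sup>2 * r ^ (2 * Suc n)" for n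
  have u: "summable u"
    using summable_bohr[OF f r, of 1] by (simp add: u_def[abs_def])
  have v: "summable v"
    unfolding v_def by (rule summable_norm0_sq[OF f r])
  have B0: "bohr_sum 0 f r = a + suminf u"
    using suminf_split_head[OF summable_bohr[OF f r, of 0]]
    by (simp add: bohr_sum_def u_def[abs_def] a_def)
  have le: "(\<Sum>n<2*K. u n) + C * (\<Sum>n<K. v n) \<le> r / (1 - r) * (1 - a\<^sup>2)" for K
  proof -
    have E: "1 - (\<Sum>j\<le>K. (cmod (taylor_coeff f j))\<^sup>2) \<ge> 0"
      using carlson_odd[OF f, of K] norm_ge_zero order_trans by blast
    have "(\<Sum>n<2*K. u n) + C * (\<Sum>n<K. v n)
       \<le> r / (1 - r) * (1 - a\<^sup>2 - r ^ (2*K) * (1 - (\<Sum>j\<le>K. (cmod (taylor_coeff f j))\<^sup>2)))"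
      using bohr_partial_sum_le[OF f r, of K] by (simp add: u_def v_def C_def a_def)
    also have "\<dots> \<le> r / (1 - r) * (1 - a\<^sup>2)"
      using E r by (intro mult_left_mono) auto
    finally show ?thesis .
  qed
  have "(\<lambda>K. \<Sum>n<2*K. u n) \<longlonglongrightarrow> suminf u"
    using LIMSEQ_subseq_LIMSEQ[OF summable_LIMSEQ[OF u], of "\<lambda>K. 2*K"]
    by (simp add: strict_mono_def o_def)
  then have "(\<lambda>K. (\<Sum>n<2*K. u n) + C * (\<Sum>n<K. v n)) \<longlonglongrightarrow> suminf u + C * suminf v"
    by (intro tendsto_intros summable_LIMSEQ[OF v])
  then have "suminf u + C * suminf v \<le> r / (1 - r) * (1 - a\<^sup>2)"
    by (rule Lim_bounded) (use le in blast)
  then show ?thesis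
    by (simp add: B0 C norm0_sq_def v_def[abs_def])
qed

section \<open>Pointwise bounds of Schwarz--Pick type\<close>

lemma schur_class_norm_less_1:
  assumes f: "f \<in> schur_class" and f0: "cmod (f 0) < 1" and z: "cmod z < 1"
  shows "cmod (f z) < 1"
proof (rule ccontr)
  assume "\<not> cmod (f z) < 1"
  then have fz: "cmod (f z) \<ge> 1" by simp
  have "f constant_on ball 0 1"
  proof (rule maximum_modulus_principle[of f "ball 0 1" "ball 0 1" z])
    show "cmod (f x) \<le> cmod (f z)" if "x \<in> ball 0 1" for x
      using f fz that order_trans unfolding schur_class_def by blast
  qed (use f z in \<open>auto simp: schur_class_def\<close>)
  then have "f z = f 0"
    using z by (auto simp: constant_on_def)
  then show False using fz f0 by simp
qed

lemma schwarz_pick_at_0: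
  assumes f: "f \<in> schur_class" and f0: "cmod (f 0) < 1" and z: "cmod z < 1"
  shows "cmod (f z - f 0) \<le> (1 - (cmod (f 0))\<^sup>2) * cmod z / (1 - cmod (f 0) * cmod z)"
proof -
  define g where "g = Moebius_function 0 (f 0) \<circ> f"
  have lt: "cmod (f x) < 1" if "cmod x < 1" for x
    using schur_class_norm_less_1[OF f f0 that] .
  have "g holomorphic_on ball 0 1"
    unfolding g_def
    by (rule holomorphic_on_compose_gen[OF _ Moebius_function_holomorphic])
       (use f lt f0 in \<open>auto simp: schur_class_def\<close>)
  then have "cmod (g z) \<le> cmod z"
  proof (rule Schwarz_Lemma(1))
    show "g 0 = 0" by (simp add: g_def Moebius_function_eq_zero)
    show "cmod (g x) < 1" if "cmod x < 1" for x
      using Moebius_function_norm_lt_1[OF f0 lt[OF that]] by (simp add: g_def)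
  qed (rule z)
  define c where "c = f 0"
  define A where "A = cmod c"
  have A: "0 \<le> A" "A < 1" using f0 by (auto simp: A_def c_def)
  have gz: "g z = (f z - c) / (1 - cnj c * f z)"
    by (simp add: g_def c_def Moebius_function_simple)
  have "cmod (cnj c * f z) < 1"
    using lt[OF z] f0 mult_strict_mono'[of "cmod c" 1 "cmod (f z)" 1]
    by (simp add: norm_mult c_def)
  then have ne: "1 - cnj c * f z \<noteq> 0" by auto
  have norm_c: "c * cnj c = of_real (A\<^sup>2)"
    by (simp add: A_def complex_norm_square del: of_real_power)
  \<comment> \<open>The bound on \<open>g z\<close> is solved for \<open>f z - c\<close>.\<close>
  have "f z - c = g z * (1 - cnj c * f z)"
    using ne by (simp add: gz)
  also have "\<dots> = g z * (of_real (1 - A\<^sup>2) - cnj c * (f z - c))"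
    using norm_c by (simp add: algebra_simps)
  finally have "cmod (f z - c) = cmod (g z) * cmod (of_real (1 - A\<^sup>2) - cnj c * (f z - c))"
    by (metis norm_mult)
  also have "\<dots> \<le> cmod z * ((1 - A\<^sup>2) + A * cmod (f z - c))"
  proof (intro mult_mono)
    have "cmod (of_real (1 - A\<^sup>2) - cnj c * (f z - c))
        \<le> cmod (of_real (1 - A\<^sup>2)) + cmod (cnj c * (f z - c))"
      by (rule norm_triangle_ineq4)
    also have "cmod (of_real (1 - A\<^sup>2)) = 1 - A\<^sup>2"
      unfolding norm_of_real using A by (simp add: power_le_one)
    finally show "cmod (of_real (1 - A\<^sup>2) - cnj c * (f z - c)) \<le> (1 - A\<^sup>2) + A * cmod (f z - c)"
      by (simp add: norm_mult A_def)
  qed (use \<open>cmod (g z) \<le> cmod z\<close> in auto)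
  finally have "cmod (f z - c) * (1 - A * cmod z) \<le> (1 - A\<^sup>2) * cmod z"
    by (simp add: algebra_simps)
  moreover have "1 - A * cmod z > 0"
    using A z mult_strict_mono'[of A 1 "cmod z" 1] by simp
  ultimately show ?thesis
    by (simp add: pos_le_divide_eq A_def c_def)
qed

lemma schur_class_order_1_norm_le:
  assumes w: "\<omega> \<in> schur_class_order 1" and z: "cmod z < 1"
  shows "cmod (\<omega> z) \<le> cmod z"
proof -
  have \<omega>: "\<omega> \<in> schur_class" and 0: "\<omega> 0 = 0"
    using w by (auto simp: schur_class_order_def)
  show ?thesis
    using schwarz_pick_at_0[OF \<omega> _ z] 0 by simp
qed

text \<open>This follows from \<open>|\<omega>\<^sub>n| \<le> 1\<close> alone and is not sharp (\<open>|z|\<^sup>m\<close> would be), but its value \<open>1/6\<close> at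
  \<open>|z| = 1/3\<close> is small enough for the functional.\<close>

lemma schur_class_order_ge_2_norm_le:
  assumes w: "\<omega> \<in> schur_class_order m" and m: "m \<ge> 2" and z: "cmod z < 1"
  shows "cmod (\<omega> z) \<le> (cmod z)\<^sup>2 / (1 - cmod z)"
proof -
  have \<omega>: "\<omega> \<in> schur_class" and vanish: "\<forall>k<m. (deriv ^^ k) \<omega> 0 = 0"
    using w by (auto simp: schur_class_order_def)
  have 0: "taylor_coeff \<omega> 0 = 0" "taylor_coeff \<omega> 1 = 0"
    using vanish[rule_format, of 0] vanish[rule_format, of 1] m
    by (simp_all add: taylor_coeff_def fps_expansion_def)
  define b where "b n = taylor_coeff \<omega> (n + 2) * z ^ (n + 2)" for n
  have "b sums (\<omega> z - (\<Sum>n<2. taylor_coeff \<omega> n * z ^ n))"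
    unfolding b_def by (rule sums_split_initial_segment[OF taylor_coeff_sums[OF \<omega> z]])
  then have b: "b sums \<omega> z"
    using 0 by (simp add: numeral_2_eq_2)
  have le: "cmod (b n) \<le> (cmod z)\<^sup>2 * cmod z ^ n" for n
    unfolding b_def norm_mult norm_power power_add
    using taylor_coeff_norm_le_1[OF \<omega>, of "n + 2"]
    by (simp add: mult.commute mult_left_le_one_le)
  have "(\<lambda>n. (cmod z)\<^sup>2 * cmod z ^ n) sums ((cmod z)\<^sup>2 * (1 / (1 - cmod z)))"
    using z by (intro sums_mult geometric_sums) simp
  then have "cmod (suminf b) \<le> (cmod z)\<^sup>2 * (1 / (1 - cmod z))"
    using norm_suminf_le[of b "\<lambda>n. (cmod z)\<^sup>2 * cmod z ^ n"] le by (metis sums_iff)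
  then show ?thesis
    using b by (simp add: sums_iff)
qed

section \<open>The extremal functions\<close>

text \<open>For \<open>|a| < 1\<close>, the disc automorphism that interchanges the real point \<open>a\<close> and \<open>0\<close>.\<close>

definition disc_swap :: "real \<Rightarrow> complex \<Rightarrow> complex" where
  "disc_swap a z = (of_real a - z) / (1 - of_real a * z)"

lemma disc_swap_schur_class:
  assumes "\<bar>a\<bar> < 1"
  shows "disc_swap a \<in> schur_class"
proof -
  have eq: "disc_swap a = (\<lambda>z. - Moebius_function 0 (of_real a) z)"
    by (rule ext) (simp only: disc_swap_def Moebius_function_simple complex_cnj_complex_of_real
        minus_divide_left minus_diff_eq)
  have a: "cmod (of_real a) < 1" using assms by simp
  show ?thesis
    unfolding eq schur_class_def
    using Moebius_function_holomorphic[OF a] Moebius_function_norm_lt_1[OF a]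
    by (auto intro!: holomorphic_intros less_imp_le)
qed

lemma taylor_coeff_disc_swap:
  "taylor_coeff (disc_swap a) n = of_real (if n = 0 then a else - (1 - a\<^sup>2) * a ^ (n - 1))"
proof -
  define c where "c = complex_of_real a"
  define F where "F = Abs_fps (\<lambda>n. if n = 0 then c else - (1 - c\<^sup>2) * c ^ (n - 1))"
  have "F * (1 - fps_const c * fps_X) = F - fps_const c * (fps_X * F)"
    by (simp add: algebra_simps)
  also have "\<dots> = fps_const c - fps_X"
  proof (rule fps_ext)
    show "fps_nth (F - fps_const c * (fps_X * F)) n = fps_nth (fps_const c - fps_X) n" for n
    proof (cases n)
      case (Suc k)
      then show ?thesis
        by (cases k) (simp_all add: F_def power2_eq_square algebra_simps)
    qed (simp add: F_def)
  qed
  finally have "F * (1 - fps_const c * fps_X) = fps_const c - fps_X" .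
  moreover have "1 - fps_const c * fps_X \<noteq> 0"
  proof
    assume "1 - fps_const c * fps_X = 0"
    then have "fps_nth (1 - fps_const c * fps_X) 0 = 0" by simp
    then show False by simp
  qed
  ultimately have F: "(fps_const c - fps_X) / (1 - fps_const c * fps_X) = F"
    by (metis nonzero_mult_div_cancel_right)
  have "(\<lambda>z. (c - z) / (1 - c * z)) has_fps_expansion
      (fps_const c - fps_X) / (1 - fps_const c * fps_X)"
    by (intro fps_expansion_intros) auto
  then have "disc_swap a has_fps_expansion F"
    unfolding F by (simp add: disc_swap_def[abs_def] c_def)
  then show ?thesis
    by (simp add: taylor_coeff_eqI F_def c_def)
qed

text \<open>The disc automorphism attains equality in the refined Bohr inequality.\<close>

lemma refined_bohr_disc_swap:
  assumes a: "0 \<le> a" "a < 1" and r: "0 \<le> r" "r < 1"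
  shows "bohr_sum 0 (disc_swap a) r
           + (1 + a * r) / ((1 + a) * (1 - r)) * norm0_sq (disc_swap a) r
         = a + r / (1 - r) * (1 - a\<^sup>2)"
proof -
  have a2: "a\<^sup>2 \<le> 1" using a by (simp add: power_le_one)
  have ar: "a * r < 1" using a r mult_strict_mono'[of a 1 r 1] by simp
  have ar0: "a * r \<ge> 0" using a r by simp
  have ar2: "a\<^sup>2 * r\<^sup>2 < 1"
    using ar ar0 by (simp add: power_less_one_iff flip: power_mult_distrib)
  have norm: "cmod (taylor_coeff (disc_swap a) (Suc n)) = (1 - a\<^sup>2) * a ^ n" for n
    unfolding taylor_coeff_disc_swap norm_of_real using a a2 by (simp add: abs_mult)
  have "(\<lambda>n. (1 - a\<^sup>2) * r * (a * r) ^ n) sums ((1 - a\<^sup>2) * r * (1 / (1 - a * r)))"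
    using ar ar0 by (intro sums_mult geometric_sums) simp
  then have "(\<lambda>n. cmod (taylor_coeff (disc_swap a) (Suc n)) * r ^ Suc n)
               sums ((1 - a\<^sup>2) * r * (1 / (1 - a * r)))"
    by (simp add: norm power_mult_distrib mult_ac)
  then have "(\<lambda>n. cmod (taylor_coeff (disc_swap a) n) * r ^ n)
               sums ((1 - a\<^sup>2) * r * (1 / (1 - a * r)) + cmod (taylor_coeff (disc_swap a) 0) * r ^ 0)"
    by (rule sums_Suc)
  then have B: "bohr_sum 0 (disc_swap a) r = a + (1 - a\<^sup>2) * r / (1 - a * r)"
    using a by (simp add: bohr_sum_def sums_iff taylor_coeff_disc_swap)
  have "(\<lambda>n. (1 - a\<^sup>2)\<^sup>2 * r\<^sup>2 * (a\<^sup>2 * r\<^sup>2) ^ n) sums ((1 - a\<^sup>2)\<^sup>2 * r\<^sup>2 * (1 / (1 - a\<^sup>2 * r\<^sup>2)))"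
    using ar2 by (intro sums_mult geometric_sums) simp
  moreover have "(cmod (taylor_coeff (disc_swap a) (Suc n)))\<^sup>2 * r ^ (2 * Suc n)
      = (1 - a\<^sup>2)\<^sup>2 * r\<^sup>2 * (a\<^sup>2 * r\<^sup>2) ^ n" for n
  proof -
    have "r ^ (2 * Suc n) = r\<^sup>2 * (r\<^sup>2) ^ n"
      by (simp only: power_mult power_Suc)
    moreover have "(a ^ n)\<^sup>2 = (a\<^sup>2) ^ n"
      by (simp add: mult.commute flip: power_mult)
    ultimately show ?thesis
      unfolding norm by (simp only: power_mult_distrib mult_ac)
  qed
  ultimately have N: "norm0_sq (disc_swap a) r = (1 - a\<^sup>2)\<^sup>2 * r\<^sup>2 / (1 - a\<^sup>2 * r\<^sup>2)"
    by (simp add: norm0_sq_def sums_iff)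
  have f1: "1 - a\<^sup>2 * r\<^sup>2 = (1 + a * r) * (1 - a * r)" "1 - a\<^sup>2 = (1 + a) * (1 - a)"
    by (simp_all add: power2_eq_square algebra_simps)
  have "(1 + a * r) / ((1 + a) * (1 - r)) * ((1 - a\<^sup>2)\<^sup>2 * r\<^sup>2 / (1 - a\<^sup>2 * r\<^sup>2))
      = (1 - a) * (1 - a\<^sup>2) * r\<^sup>2 / ((1 - r) * (1 - a * r))"
  proof -
    have "1 + a * r \<noteq> 0" "1 + a \<noteq> 0" "1 - r \<noteq> 0" "1 - a * r \<noteq> 0"
      using a r ar ar0 by linarith+
    then show ?thesis
      unfolding f1 by (simp add: divide_simps power2_eq_square)
  qed
  moreover have "(1 - a\<^sup>2) * r / (1 - a * r) + (1 - a) * (1 - a\<^sup>2) * r\<^sup>2 / ((1 - r) * (1 - a * r))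
      = r / (1 - r) * (1 - a\<^sup>2)"
  proof -
    have "1 - r \<noteq> 0" "1 - a * r \<noteq> 0"
      using a r ar by auto
    then show ?thesis
      by (simp add: divide_simps) (simp add: algebra_simps power2_eq_square)
  qed
  ultimately show ?thesis by (simp add: B N)
qed

lemma power_schur_class_order: "(\<lambda>z. z ^ m) \<in> schur_class_order m"
proof -
  have "(deriv ^^ k) (\<lambda>z::complex. z ^ m) 0 = (if k = m then fact m else 0)" if "k \<le> m" for k
    using higher_deriv_power[of k "0::complex" m 0] that
    by (auto simp: pochhammer_fact)
  then show ?thesis
    by (auto simp: schur_class_order_def schur_class_def norm_power power_le_one
        intro!: holomorphic_intros)
qed

section \<open>The Bohr-type functional\<close>

text \<open>The first two terms of the functional leave room \<open>(1 - a)\<^sup>2 / 2\<close> for the third when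
  \<open>r \<le> 1/3\<close>, and the hypothesis on \<open>\<omega> z\<close> says that the Schwarz--Pick bound fits into it.\<close>

lemma bohr_functional_le_1:
  assumes f: "f \<in> schur_class" and z: "cmod z \<le> 1/3" and w: "cmod (\<omega> z) < 1"
  defines "a \<equiv> cmod (taylor_coeff f 0)"
  assumes small: "sqrt 2 * (1 + a) * cmod (\<omega> z) \<le> 1 - a * cmod (\<omega> z)"
  shows "bohr_functional f \<omega> z \<le> 1"
proof -
  define r where "r = cmod z"
  define s where "s = cmod (\<omega> z)"
  define D where "D = cmod (f (\<omega> z) - taylor_coeff f 0)"
  have r: "0 \<le> r" "r \<le> 1/3" and s: "0 \<le> s" "s < 1"
    using z w by (auto simp: r_def s_def)
  have a: "0 \<le> a" "a \<le> 1"
    using taylor_coeff_norm_le_1[OF f] by (auto simp: a_def)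
  have "2 * D\<^sup>2 \<le> (1 - a)\<^sup>2"
  proof (cases "a < 1")
    case True
    have as: "1 - a * s > 0"
      using a s True mult_strict_mono'[of a 1 s 1] by simp
    have "D \<le> (1 - a\<^sup>2) * s / (1 - a * s)"
      using schwarz_pick_at_0[OF f _ w] True
      by (simp add: D_def a_def s_def taylor_coeff_0)
    then have "sqrt 2 * D \<le> sqrt 2 * ((1 - a\<^sup>2) * s / (1 - a * s))"
      by (intro mult_left_mono) auto
    also have "\<dots> = (1 - a) * (sqrt 2 * (1 + a) * s) / (1 - a * s)"
      by (simp add: power2_eq_square algebra_simps)
    also have "\<dots> \<le> (1 - a) * (1 - a * s) / (1 - a * s)"
      using small a as by (intro divide_right_mono mult_left_mono) (auto simp: s_def)
    also have "\<dots> = 1 - a"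
      using as by simp
    finally have "(sqrt 2 * D)\<^sup>2 \<le> (1 - a)\<^sup>2"
      by (intro power_mono) (auto simp: D_def)
    then show ?thesis by (simp add: power_mult_distrib)
  next
    case False
    then have f0: "cmod (f 0) = 1"
      using a by (simp add: a_def taylor_coeff_0)
    have "f constant_on ball 0 1"
      by (rule maximum_modulus_principle[of f "ball 0 1" "ball 0 1" 0])
         (use f f0 in \<open>auto simp: schur_class_def\<close>)
    then have "f (\<omega> z) = f 0"
      using w by (auto simp: constant_on_def)
    then show ?thesis by (simp add: D_def taylor_coeff_0)
  qed
  moreover have "r / (1 - r) * (1 - a\<^sup>2) \<le> 1/2 * (1 - a\<^sup>2)"
    using r a by (intro mult_right_mono) (auto simp: divide_simps power_le_one)
  moreover have "bohr_functional f \<omega> z \<le> a + r / (1 - r) * (1 - a\<^sup>2) + D\<^sup>2"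
    using refined_bohr[OF f, of r] r by (simp add: bohr_functional_def Let_def a_def r_def D_def)
  moreover have "a + 1/2 * (1 - a\<^sup>2) + (1 - a)\<^sup>2 / 2 = 1"
    by (simp add: power2_eq_square field_simps)
  ultimately show ?thesis by linarith
qed

lemma bohr_functional_disc_swap:
  assumes a: "0 \<le> a" "a < 1" and r: "0 \<le> r" "r < 1"
  shows "bohr_functional (disc_swap a) \<omega> (of_real r)
           = a + r / (1 - r) * (1 - a\<^sup>2) + (cmod (disc_swap a (\<omega> (of_real r)) - of_real a))\<^sup>2"
  using refined_bohr_disc_swap[OF a r] a r
  by (simp add: bohr_functional_def Let_def taylor_coeff_disc_swap)

text \<open>For \<open>\<omega> z = z\<close> the third term attains the Schwarz--Pick bound as well, so the last
  hypothesis is the strict reversal of the one in \<open>bohr_functional_le_1\<close>.\<close>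

lemma bohr_functional_disc_swap_id_gt_1:
  assumes a: "0 \<le> a" "a < 1" and r: "1/3 \<le> r" "r < 1"
    and large: "sqrt 2 * (1 + a) * r > 1 - a * r"
  shows "bohr_functional (disc_swap a) (\<lambda>z. z ^ 1) (of_real r) > 1"
proof -
  have ar: "1 - a * r > 0"
    using a r mult_strict_mono'[of a 1 r 1] by simp
  define D where "D = (1 - a\<^sup>2) * r / (1 - a * r)"
  have "disc_swap a (of_real r) - of_real a = of_real ((a - r) / (1 - a * r) - a)"
    by (simp add: disc_swap_def)
  also have "(a - r) / (1 - a * r) - a = - D"
    using ar by (simp add: D_def divide_simps) (simp add: algebra_simps power2_eq_square)
  finally have D: "(cmod (disc_swap a (of_real r) - of_real a))\<^sup>2 = D\<^sup>2"
    by simp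
  have "1 - a = (1 - a) * (1 - a * r) / (1 - a * r)"
    using ar by simp
  also have "\<dots> < (1 - a) * (sqrt 2 * (1 + a) * r) / (1 - a * r)"
    using large a ar by (intro divide_strict_right_mono mult_strict_left_mono) auto
  also have "\<dots> = sqrt 2 * D"
    by (simp add: D_def power2_eq_square algebra_simps)
  finally have "(1 - a)\<^sup>2 < (sqrt 2 * D)\<^sup>2"
    using a by (intro power_strict_mono) auto
  then have "(1 - a)\<^sup>2 < 2 * D\<^sup>2"
    by (simp add: power_mult_distrib)
  moreover have "r / (1 - r) * (1 - a\<^sup>2) \<ge> 1/2 * (1 - a\<^sup>2)"
    using r a by (intro mult_right_mono) (auto simp: divide_simps power_le_one)
  moreover have "a + 1/2 * (1 - a\<^sup>2) + (1 - a)\<^sup>2 / 2 = 1"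
    by (simp add: power2_eq_square field_simps)
  moreover have "bohr_functional (disc_swap a) (\<lambda>z. z ^ 1) (of_real r)
      = a + r / (1 - r) * (1 - a\<^sup>2) + D\<^sup>2"
    using bohr_functional_disc_swap[OF a, of r "\<lambda>z. z ^ 1"] r D by simp
  ultimately show ?thesis by linarith
qed

section \<open>Sharp ranges of the parameters\<close>

theorem theorem5:
  shows "(\<forall>a::real. 0 \<le> a \<and> a < 1 \<longrightarrow>
            ((\<forall>f\<in>schur_class. \<forall>\<omega>\<in>schur_class_order 1. cmod (taylor_coeff f 0) = a \<longrightarrow>
                (\<forall>z. cmod z \<le> 1/3 \<longrightarrow> bohr_functional f \<omega> z \<le> 1))
             \<longleftrightarrow> a \<le> - 5 + 4 * sqrt 2))
       \<and> (\<forall>R::real. R > 1/3 \<longrightarrow>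
            (\<exists>f\<in>schur_class. \<exists>\<omega>\<in>schur_class_order 1. \<exists>z.
               cmod (taylor_coeff f 0) \<le> - 5 + 4 * sqrt 2 \<and>
               cmod z < 1 \<and> cmod z \<le> R \<and> bohr_functional f \<omega> z > 1))
       \<and> (\<forall>m::nat. m \<ge> 2 \<longrightarrow>
            (\<forall>f\<in>schur_class. \<forall>\<omega>\<in>schur_class_order m.
               \<forall>z. cmod z \<le> 1/3 \<longrightarrow> bohr_functional f \<omega> z \<le> 1)
          \<and> (\<forall>R::real. R > 1/3 \<longrightarrow>
               (\<exists>f\<in>schur_class. \<exists>\<omega>\<in>schur_class_order m. \<exists>z.
                  cmod z < 1 \<and> cmod z \<le> R \<and> bohr_functional f \<omega> z > 1)))"
proof -
  define c where "c = - 5 + 4 * sqrt (2::real)"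
  have "1.4 < sqrt (2::real)"
    by (rule real_less_rsqrt) (simp add: power2_eq_square)
  moreover have "sqrt (2::real) < 1.5"
    by (rule real_less_lsqrt) (simp_all add: power2_eq_square)
  ultimately have s2: "sqrt 2 * sqrt 2 = (2::real)" "sqrt 2 > (1.4::real)" "sqrt 2 < (1.5::real)"
    by simp_all
  have c01: "0 \<le> c" "c < 1"
    using s2 by (simp_all add: c_def)
  \<comment> \<open>At \<open>r = 1/3\<close>, \<open>c\<close> is where the Schwarz--Pick bound exactly exhausts the available room.\<close>
  have c_iff: "sqrt 2 * (1 + a) + a \<le> 3 \<longleftrightarrow> a \<le> c" for a :: real
  proof -
    have "3 - (sqrt 2 * (1 + a) + a) = (sqrt 2 + 1) * (c - a)"
      using s2(1) by (simp add: c_def algebra_simps)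
    moreover have "0 \<le> (sqrt 2 + 1) * (c - a) \<longleftrightarrow> 0 \<le> c - a"
      using s2(2) by (intro zero_le_mult_iff[THEN trans]) auto
    ultimately show ?thesis by linarith
  qed
  have le_1: "bohr_functional f \<omega> z \<le> 1"
    if f: "f \<in> schur_class" and \<omega>: "\<omega> \<in> schur_class_order 1"
      and a: "cmod (taylor_coeff f 0) \<le> c" and z: "cmod z \<le> 1/3" for f \<omega> z
  proof (rule bohr_functional_le_1[OF f z])
    define a where "a = cmod (taylor_coeff f 0)"
    have w: "cmod (\<omega> z) \<le> 1/3"
      using schur_class_order_1_norm_le[OF \<omega>, of z] z by simp
    then show "cmod (\<omega> z) < 1" by simp
    have "(sqrt 2 * (1 + a) + a) * cmod (\<omega> z) \<le> 3 * (1/3)"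
      using w a c_iff[of a] by (intro mult_mono) (auto simp: a_def)
    then show "sqrt 2 * (1 + cmod (taylor_coeff f 0)) * cmod (\<omega> z)
        \<le> 1 - cmod (taylor_coeff f 0) * cmod (\<omega> z)"
      by (simp add: a_def algebra_simps)
  qed
  have iff: "(\<forall>f\<in>schur_class. \<forall>\<omega>\<in>schur_class_order 1. cmod (taylor_coeff f 0) = a \<longrightarrow>
                (\<forall>z. cmod z \<le> 1/3 \<longrightarrow> bohr_functional f \<omega> z \<le> 1)) \<longleftrightarrow> a \<le> c"
    if a: "0 \<le> a" "a < 1" for a :: real
  proof (intro iffI)
    assume H: "\<forall>f\<in>schur_class. \<forall>\<omega>\<in>schur_class_order 1. cmod (taylor_coeff f 0) = a \<longrightarrow>
                (\<forall>z. cmod z \<le> 1/3 \<longrightarrow> bohr_functional f \<omega> z \<le> 1)"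
    show "a \<le> c"
    proof (rule ccontr)
      assume "\<not> a \<le> c"
      then have "sqrt 2 * (1 + a) * (1/3) > 1 - a * (1/3)"
        using c_iff[of a] by simp
      then have "bohr_functional (disc_swap a) (\<lambda>z. z ^ 1) (of_real (1/3)) > 1"
        by (intro bohr_functional_disc_swap_id_gt_1 a) auto
      moreover have "disc_swap a \<in> schur_class" "cmod (taylor_coeff (disc_swap a) 0) = a"
        using a by (auto simp: disc_swap_schur_class taylor_coeff_disc_swap)
      moreover have "cmod (of_real (1/3)) \<le> 1/3"
        unfolding norm_of_real by simp
      ultimately show False
        using H power_schur_class_order[of 1] by (meson not_le)
    qed
  qed (use le_1 in blast)
  have sharp_1: "\<exists>f\<in>schur_class. \<exists>\<omega>\<in>schur_class_order 1. \<exists>z.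
               cmod (taylor_coeff f 0) \<le> c \<and>
               cmod z < 1 \<and> cmod z \<le> R \<and> bohr_functional f \<omega> z > 1"
    if R: "R > 1/3" for R :: real
  proof -
    define r where "r = min R (1/2)"
    have r: "1/3 < r" "r < 1" "r \<le> R" using R by (auto simp: r_def)
    have "sqrt 2 * (1 + c) + c = 3"
      using s2(1) by (simp add: c_def algebra_simps)
    then have "(sqrt 2 * (1 + c) + c) * r > 1"
      using r by simp
    then have "sqrt 2 * (1 + c) * r > 1 - c * r"
      by (simp add: algebra_simps)
    then have "bohr_functional (disc_swap c) (\<lambda>z. z ^ 1) (of_real r) > 1"
      using r by (intro bohr_functional_disc_swap_id_gt_1 c01) auto
    moreover have "disc_swap c \<in> schur_class" "cmod (taylor_coeff (disc_swap c) 0) = c"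
      using c01 by (auto simp: disc_swap_schur_class taylor_coeff_disc_swap)
    moreover have "cmod (of_real r) = r"
      using r by simp
    ultimately show ?thesis
      using r power_schur_class_order[of 1] by (metis order_refl)
  qed
  have le_m: "bohr_functional f \<omega> z \<le> 1"
    if f: "f \<in> schur_class" and \<omega>: "\<omega> \<in> schur_class_order m" and m: "m \<ge> 2"
      and z: "cmod z \<le> 1/3" for f \<omega> z m
  proof (rule bohr_functional_le_1[OF f z])
    define a where "a = cmod (taylor_coeff f 0)"
    have a: "0 \<le> a" "a \<le> 1"
      using taylor_coeff_norm_le_1[OF f] by (auto simp: a_def)
    have "cmod (\<omega> z) \<le> (cmod z)\<^sup>2 / (1 - cmod z)"
      using schur_class_order_ge_2_norm_le[OF \<omega> m] z by simp
    also have "\<dots> \<le> (1/3)\<^sup>2 / (1 - 1/3)"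
      using z by (intro frac_le power_mono) auto
    finally have w: "cmod (\<omega> z) \<le> 1/6" by (simp add: power2_eq_square)
    then show "cmod (\<omega> z) < 1" by simp
    have "sqrt 2 * (1 + a) \<le> 1.5 * 2"
      using a s2 by (intro mult_mono) auto
    then have "(sqrt 2 * (1 + a) + a) * cmod (\<omega> z) \<le> 6 * (1/6)"
      using a w by (intro mult_mono) auto
    then show "sqrt 2 * (1 + cmod (taylor_coeff f 0)) * cmod (\<omega> z)
        \<le> 1 - cmod (taylor_coeff f 0) * cmod (\<omega> z)"
      by (simp add: a_def algebra_simps)
  qed
  have sharp_m: "\<exists>f\<in>schur_class. \<exists>\<omega>\<in>schur_class_order m. \<exists>z.
                  cmod z < 1 \<and> cmod z \<le> R \<and> bohr_functional f \<omega> z > 1"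
    if R: "R > 1/3" for R :: real and m
  proof -
    define r where "r = min R (1/2)"
    have r: "1/3 < r" "r \<le> 1/2" "r \<le> R" using R by (auto simp: r_def)
    \<comment> \<open>The first two terms alone exceed \<open>1\<close> once \<open>a > (1 - 2 * r) / r\<close>; this \<open>a\<close> is the midpoint
        between that number and \<open>1\<close>.\<close>
    define a where "a = (1 - r) / (2 * r)"
    have a: "0 \<le> a" "a < 1"
      using r by (auto simp: a_def divide_simps)
    have "r / (1 - r) * (1 + a) = (1 + r) / (2 * (1 - r))"
      using r by (simp add: a_def divide_simps) (simp add: algebra_simps)
    also have "\<dots> > 1"
      using r by (simp add: divide_simps)
    finally have "(1 - a) * (r / (1 - r) * (1 + a)) > (1 - a) * 1"
      using a by (intro mult_strict_left_mono) auto
    then have "a + r / (1 - r) * (1 - a\<^sup>2) > 1"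
      by (simp add: power2_eq_square algebra_simps)
    then have "bohr_functional (disc_swap a) (\<lambda>z. z ^ m) (of_real r) > 1"
      using r bohr_functional_disc_swap[OF a, of r "\<lambda>z. z ^ m"]
        zero_le_power2[of "cmod (disc_swap a (of_real r ^ m) - of_real a)"] by linarith
    moreover have "disc_swap a \<in> schur_class"
      using a by (auto simp: disc_swap_schur_class)
    moreover have "cmod (of_real r) = r" "r < 1"
      using r by auto
    ultimately show ?thesis
      using r power_schur_class_order[of m] by metis
  qed
  show ?thesis
    using iff sharp_1 le_m sharp_m unfolding c_def by blast
qed

end
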